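(* Assume that a function $h:{}^{\omega}\mathbb{R}\times{}^{\omega}\mathbb{R}\to\mathbb{R}$ is such that one of the following conditions holds: (A) $\kappa(h,1)<2^{\kappa(h,1)}=\mathfrak{c}$, or (B) $\kappa(h,1)\leq\mu<\mathfrak{c}$ for some regular cardinal $\mu$, or (C) $\kappa^-(h,2)\leq\mu<\mathfrak{c}$ for some regular cardinal $\mu$. Then $(\circledast^{\mathrm{Da}}_h)$ fails.
   Context: $\mathfrak{c}$ denotes the cardinality of $\mathbb{R}$; ${}^{\omega}\mathbb{R}$ is the set of sequences $\langle c_n:n<\omega\rangle$ of reals; $\mathcal{P}(X)$ is the power set of $X$, and $[X]^n$ is the set of $n$-element subsets of $X$. Regular cardinals are infinite. For a function $h$ with $\mathrm{dom}(h)\subseteq\mathcal{X}\times\mathcal{Y}$ and $\mathrm{rng}(h)\subseteq\mathcal{Z}$ and a positive integer $n$, $\kappa(h,n)$ is the minimum of $|\mathcal{A}_0|+|\mathcal{A}_1|$ over all pairs $\mathcal{A}_0\subseteq\mathcal{P}(\mathcal{X})$, $\mathcal{A}_1\subseteq\mathcal{P}(\mathcal{Y})$ such that: every $w\in[\mathcal{X}]^n$ is contained in some $A\in\mathcal{A}_0$; every $w\in[\mathcal{Y}]^n$ is contained in some $A\in\mathcal{A}_1$; and $h[A_0\times A_1]\neq\mathcal{Z}$ for all $A_0\in\mathcal{A}_0$, $A_1\in\mathcal{A}_1$. If $\mathcal{X}=\mathcal{Y}$, then $\kappa^-(h,n)$ is the minimum of $|\mathcal{A}|$ over all $\mathcal{A}\subseteq\mathcal{P}(\mathcal{X})$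 such that every $w\in[\mathcal{X}]^n$ is contained in some $A\in\mathcal{A}$, and $h[A\times A]\neq\mathcal{Z}$ for all $A\in\mathcal{A}$. Here these are used with $\mathcal{X}=\mathcal{Y}={}^{\omega}\mathbb{R}$ and $\mathcal{Z}=\mathbb{R}$. For $h:{}^{\omega}\mathbb{R}\times{}^{\omega}\mathbb{R}\to\mathbb{R}$, $(\circledast^{\mathrm{Da}}_h)$ is the statement: for each $f:\mathbb{R}\times\mathbb{R}\to\mathbb{R}$ there are functions $g^0_n,g^1_n:\mathbb{R}\to\mathbb{R}$ (for $n<\omega$) such that for all $x,y\in\mathbb{R}$, $f(x,y)=h(\langle g^0_n(x):n<\omega\rangle,\langle g^1_n(y):n<\omega\rangle)$. *)

theory Defs
  imports "HOL-Analysis.Analysis"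
begin

unbundle cardinal_syntax

text \<open>
  Cardinals are represented, as in the library, by cardinal orders, which are
  determined only up to \<open>=o\<close>. The least element of a class of cardinals is therefore
  a chosen \<open>\<le>o\<close>-minimal member.
\<close>

definition least_card :: "'a rel set \<Rightarrow> 'a rel" where
  "least_card R = (SOME r. r \<in> R \<and> (\<forall>r' \<in> R. r \<le>o r'))"

lemma least_card:
  assumes "R \<noteq> {}" "\<forall>r \<in> R. Card_order r"
  shows "least_card R \<in> R" and "r' \<in> R \<Longrightarrow> least_card R \<le>o r'"
proof -
  have "\<exists>r. r \<in> R \<and> (\<forall>r' \<in> R. r \<le>o r')"
    using exists_minim_Card_order[OF assms] by blast
  from someI_ex[OF this]
  have *: "least_card R \<in> R \<and> (\<forall>r' \<in> R. least_card R \<le>o r')"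
    unfolding least_card_def .
  show "least_card R \<in> R" using * by blast
  show "r' \<in> R \<Longrightarrow> least_card R \<le>o r'" using * by blast
qed

definition n_cover :: "nat \<Rightarrow> 'a set set \<Rightarrow> bool" where
  "n_cover n \<A> \<longleftrightarrow> (\<forall>w. finite w \<and> card w = n \<longrightarrow> (\<exists>A \<in> \<A>. w \<subseteq> A))"

text \<open>
  The sets \<open>\<X>\<close>, \<open>\<Y>\<close>, \<open>\<Z>\<close> are the universes of the types \<open>'x\<close>, \<open>'y\<close>, \<open>'z\<close>,
  and \<open>h\<close> is total on \<open>\<X> \<times> \<Y>\<close>.
\<close>

definition kappa :: "('x \<times> 'y \<Rightarrow> 'z) \<Rightarrow> nat \<Rightarrow> ('x set + 'y set) rel" where
  "kappa h n = least_card {|\<A>\<^sub>0| +c |\<A>\<^sub>1| | \<A>\<^sub>0 \<A>\<^sub>1.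
     n_cover n \<A>\<^sub>0 \<and> n_cover n \<A>\<^sub>1 \<and>
     (\<forall>A\<^sub>0 \<in> \<A>\<^sub>0. \<forall>A\<^sub>1 \<in> \<A>\<^sub>1. h ` (A\<^sub>0 \<times> A\<^sub>1) \<noteq> UNIV)}"

definition kappa_minus :: "('x \<times> 'x \<Rightarrow> 'z) \<Rightarrow> nat \<Rightarrow> 'x set rel" where
  "kappa_minus h n = least_card {|\<A>| | \<A>.
     n_cover n \<A> \<and> (\<forall>A \<in> \<A>. h ` (A \<times> A) \<noteq> UNIV)}"

text \<open>
  If \<open>\<Z>\<close> is infinite, the families over which the minima are taken exist, because the
  \<open>n\<close>-element sets themselves form an admissible family.
\<close>

lemma n_cover_n_sets: "n_cover n {w. finite w \<and> card w = n}"
  unfolding n_cover_def by blast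

lemma finite_image_neq_UNIV:
  assumes "infinite (UNIV :: 'z set)" "finite A" "finite B"
  shows "(h :: 'x \<times> 'y \<Rightarrow> 'z) ` (A \<times> B) \<noteq> UNIV"
  proof
  assume "h ` (A \<times> B) = UNIV"
  moreover have "finite (h ` (A \<times> B))" using assms(2,3) by blast
  ultimately show False using assms(1) by simp
qed

lemma kappa_attained:
  fixes h :: "'x \<times> 'y \<Rightarrow> 'z"
  assumes "infinite (UNIV :: 'z set)"
  obtains \<A>\<^sub>0 \<A>\<^sub>1 where "kappa h n = |\<A>\<^sub>0| +c |\<A>\<^sub>1|" "n_cover n \<A>\<^sub>0" "n_cover n \<A>\<^sub>1"
    "\<And>A\<^sub>0 A\<^sub>1. A\<^sub>0 \<in> \<A>\<^sub>0 \<Longrightarrow> A\<^sub>1 \<in> \<A>\<^sub>1 \<Longrightarrow> h ` (A\<^sub>0 \<times> A\<^sub>1) \<noteq> UNIV"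
proof -
  let ?R = "{|\<A>\<^sub>0| +c |\<A>\<^sub>1| | \<A>\<^sub>0 \<A>\<^sub>1. n_cover n \<A>\<^sub>0 \<and> n_cover n \<A>\<^sub>1 \<and>
     (\<forall>A\<^sub>0 \<in> \<A>\<^sub>0. \<forall>A\<^sub>1 \<in> \<A>\<^sub>1. h ` (A\<^sub>0 \<times> A\<^sub>1) \<noteq> UNIV)}"
  have "|{w :: 'x set. finite w \<and> card w = n}| +c |{w :: 'y set. finite w \<and> card w = n}| \<in> ?R"
    by (rule CollectI, rule exI, rule exI, rule conjI[OF refl])
      (simp add: n_cover_n_sets finite_image_neq_UNIV[OF assms])
  then have "?R \<noteq> {}" by blast
  moreover have "\<forall>r \<in> ?R. Card_order r" using Card_order_csum by blast
  ultimately have "kappa h n \<in> ?R" unfolding kappa_def by (rule least_card)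
  then show thesis by (elim CollectE exE conjE) (rule that, assumption+, drule (1) bspec, erule (1) bspec)
qed

lemma kappa_minus_attained:
  fixes h :: "'x \<times> 'x \<Rightarrow> 'z"
  assumes "infinite (UNIV :: 'z set)"
  obtains \<A> where "kappa_minus h n = |\<A>|" "n_cover n \<A>"
    "\<And>A. A \<in> \<A> \<Longrightarrow> h ` (A \<times> A) \<noteq> UNIV"
proof -
  let ?R = "{|\<A>| | \<A>. n_cover n \<A> \<and> (\<forall>A \<in> \<A>. h ` (A \<times> A) \<noteq> UNIV)}"
  have "|{w :: 'x set. finite w \<and> card w = n}| \<in> ?R"
    by (rule CollectI, rule exI, rule conjI[OF refl])
      (simp add: n_cover_n_sets finite_image_neq_UNIV[OF assms])
  then have "?R \<noteq> {}" by blast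
  moreover have "\<forall>r \<in> ?R. Card_order r" using card_of_Card_order by blast
  ultimately have "kappa_minus h n \<in> ?R" unfolding kappa_minus_def by (rule least_card)
  then show thesis by (elim CollectE exE conjE) (rule that, assumption+, erule (1) bspec)
qed

definition regular_cardinal :: "'a rel \<Rightarrow> bool" where
  "regular_cardinal \<mu> \<longleftrightarrow> Cinfinite \<mu> \<and> regularCard \<mu>"

abbreviation continuum :: "real rel" where
  "continuum \<equiv> |UNIV :: real set|"

definition Da :: "((nat \<Rightarrow> real) \<times> (nat \<Rightarrow> real) \<Rightarrow> real) \<Rightarrow> bool" where
  "Da h \<longleftrightarrow> (\<forall>f :: real \<times> real \<Rightarrow> real. \<exists>g\<^sub>0 g\<^sub>1 :: nat \<Rightarrow> real \<Rightarrow> real.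
     \<forall>x y. f (x, y) = h (\<lambda>n. g\<^sub>0 n x, \<lambda>n. g\<^sub>1 n y))"

end

theory Submission
  imports Defs
begin

text \<open>
  Suppose that the domain of \<open>h\<close> is covered by rectangles \<open>\<A> i \<times> \<B> i\<close>, \<open>i \<in> I\<close>, such that \<open>h\<close> omits
  a value \<open>c i\<close> on each of them. If \<open>f (x, y) = h (G\<^sub>0 x, G\<^sub>1 y)\<close>, then the preimages of these
  rectangles under \<open>G\<^sub>0\<close> and \<open>G\<^sub>1\<close> cover \<open>\<real> \<times> \<real>\<close>, and \<open>f\<close> omits \<open>c i\<close> on the \<open>i\<close>-th one.
  So it is enough to find an \<open>f\<close> that does not allow this, whatever \<open>G\<^sub>0\<close> and \<open>G\<^sub>1\<close> are. Such an
  \<open>f\<close> may depend on \<open>h\<close> and the rectangles.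

  If \<open>2\<^sup>\<kappa> = \<cc>\<close> for \<open>\<kappa> = \<kappa>(h, 1)\<close>, there are only \<open>\<cc>\<close> functions from the second covering
  family to \<open>\<real>\<close>, and \<open>f\<close> can enumerate all of them as its columns; one column is then made of
  omitted values (\<open>Da_fails_if_columns_enumerable\<close>).

  In the two other cases there are at most \<open>\<mu>\<close> rectangles, \<open>\<mu>\<close> regular and \<open>\<mu>\<^sup>+ \<le> \<cc>\<close>. It
  suffices to colour \<open>\<mu>\<^sup>+ \<times> (\<mu>\<^sup>+ \<times> \<mu>\<^sup>+)\<close> with the elements of \<open>I\<close> in such a way that for any
  subsets \<open>B i\<close> of \<open>\<mu>\<^sup>+\<close> of cardinality \<open>\<mu>\<^sup>+\<close> there is one \<open>y\<close> such that all colours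
  occur on each \<open>B i \<times> {y}\<close> (\<open>onto_colouring\<close>). Indeed, let \<open>f (x, y) = c (col x y)\<close>, and
  let \<open>B i\<close> be the preimage of \<open>\<A> i\<close>; take the \<open>y\<close> that works for those \<open>B i\<close> that have
  cardinality \<open>\<mu>\<^sup>+\<close>, a point \<open>x\<close> outside the other ones, and a rectangle \<open>i\<close> that contains the
  image of \<open>(x, y)\<close>. Some \<open>x' \<in> B i\<close> has colour \<open>i\<close>, so \<open>f (x', y) = c i\<close> is not omitted
  (\<open>unrepresentable_if_rectangle_cover\<close>).

  For the colouring, fix injections \<open>e x\<close> of the predecessors of \<open>x < \<mu>\<^sup>+\<close> into \<open>\<mu>\<close>, and a
  function \<open>q\<close> on \<open>\<mu>\<^sup>+\<close> each of whose fibres contains, for any \<open>\<mu>\<close> given sets of cardinality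
  \<open>\<mu>\<^sup>+\<close>, an ordinal of cofinality \<open>\<mu>\<close> that is a limit of all of them (Ulam's matrix argument,
  \<open>positive_partition\<close>). Then \<open>col a (b, c) = q g\<close>, where \<open>g\<close> is the least ordinal in \<open>[a, b)\<close>
  with \<open>e b g \<le> n\<close>, and \<open>n = e a c\<close>. To hit the colour \<open>j\<close>, take such a limit point \<open>g\<close>
  with \<open>q g = j\<close>, and \<open>b > g\<close>. For \<open>n \<ge> e b g\<close> fewer than \<open>\<mu>\<close> ordinals \<open>x < g\<close> satisfy
  \<open>e b x \<le> n\<close>, so they are bounded below \<open>g\<close>, and \<open>g\<close> is the ordinal selected by every
  \<open>a < g\<close> close to \<open>g\<close> with \<open>e a c = n\<close>. The parameter \<open>c\<close> is there to supply such \<open>a\<close>: for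
  all but \<open>\<mu>\<close> many \<open>c\<close>, the set \<open>{a \<in> B. e a c = n}\<close> has cardinality \<open>\<mu>\<^sup>+\<close> for arbitrarily
  large \<open>n < \<mu>\<close> (\<open>few_bounded_levels\<close>), so that \<open>g\<close> can be chosen as a limit of all these sets.

  In the names of the lemmas, a set is small if its cardinality is at most \<open>\<mu>\<close>, and big otherwise.
\<close>

section \<open>Small and big sets\<close>

lemma small_UN:
  assumes "Cinfinite r" "|I| \<le>o r" "\<And>i. i \<in> I \<Longrightarrow> |A i| \<le>o r"
  shows "|\<Union>i\<in>I. A i| \<le>o r"
  using assms by (intro UNION_Cinfinite_bound) auto

lemma small_subset:
  assumes "A \<subseteq> B" "|B| \<le>o r"
  shows "|A| \<le>o r"
  using assms card_of_mono1 ordLeq_transitive by blast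

lemma big_not_covered:
  assumes "\<not> |B| \<le>o r" "|A| \<le>o r"
  obtains b where "b \<in> B" "b \<notin> A"
proof -
  have "\<not> B \<subseteq> A" using assms small_subset by metis
  then show thesis using that by auto
qed

lemma big_fibre:
  assumes "Cinfinite r" "|I| \<le>o r" "\<not> |B| \<le>o r" "f ` B \<subseteq> I"
  obtains i where "i \<in> I" "\<not> |{b \<in> B. f b = i}| \<le>o r"
proof -
  have "B = (\<Union>i\<in>I. {b \<in> B. f b = i})" using assms(4) by auto
  then show thesis using small_UN[OF assms(1,2), of "\<lambda>i. {b \<in> B. f b = i}"] assms(3) that
    by metis
qed

section \<open>The successor of a regular cardinal\<close>

text \<open>
  The well-order \<open>W\<close> is a copy of \<open>\<mu>\<^sup>+\<close>, and \<open>e x\<close> numbers the predecessors of \<open>x\<close> by elements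
  of \<open>\<mu>\<close>.
\<close>

locale regular_successor =
  fixes \<mu> :: "'m rel" and W :: "'a rel" and e :: "'a \<Rightarrow> 'a \<Rightarrow> 'm"
  assumes regular: "regular_cardinal \<mu>"
    and card_W: "Card_order W"
    and succ: "W =o cardSuc \<mu>"
    and inj_e: "\<And>x. x \<in> Field W \<Longrightarrow> inj_on (e x) (underS W x)"
    and range_e: "\<And>x y. y \<in> underS W x \<Longrightarrow> e x y \<in> Field \<mu>"
begin

abbreviation less (infix "\<sqsubset>" 50) where "x \<sqsubset> y \<equiv> x \<in> underS W y"

lemma Cinf: "Cinfinite \<mu>" and Cmu: "Card_order \<mu>" and inf_mu: "infinite (Field \<mu>)"
  using regular unfolding regular_cardinal_def cinfinite_def by auto

lemma wo_W: "wo_rel W" and wo_mu: "wo_rel \<mu>"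
  using card_W Cmu unfolding wo_rel_def card_order_on_def by auto

lemma less_trans: "x \<sqsubset> y \<Longrightarrow> y \<sqsubset> z \<Longrightarrow> x \<sqsubset> z"
  using wo_rel.TRANS[OF wo_W] wo_rel.ANTISYM[OF wo_W]
  unfolding underS_def trans_def antisym_def by blast

lemma less_irrefl: "\<not> x \<sqsubset> x"
  unfolding underS_def by blast

lemma less_total:
  assumes "x \<in> Field W" "y \<in> Field W"
  shows "x \<sqsubset> y \<or> x = y \<or> y \<sqsubset> x"
  using wo_rel.TOTALS[OF wo_W] assms unfolding underS_def by blast

lemma less_Field: "x \<sqsubset> y \<Longrightarrow> x \<in> Field W \<and> y \<in> Field W"
  unfolding underS_def Field_def by blast

lemma less_minimal:
  assumes "x \<in> Q"
  obtains z where "z \<in> Q" "\<And>y. y \<sqsubset> z \<Longrightarrow> y \<notin> Q"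
proof -
  obtain z where "z \<in> Q" "\<And>y. (y, z) \<in> W - Id \<Longrightarrow> y \<notin> Q"
    using wfE_min[OF wo_rel.WF[OF wo_W] assms] by blast
  then show thesis using that unfolding underS_def by blast
qed

lemma card_mu: "|Field \<mu>| \<le>o \<mu>"
  using card_of_Field_ordIso[OF Cmu] ordIso_imp_ordLeq by blast

lemma finite_less: "finite A \<Longrightarrow> |A| <o \<mu>"
  by (rule Cfinite_ordLess_Cinfinite[OF _ Cinf])
    (simp add: cfinite_def Field_card_of card_of_card_order_on)

lemma finite_small: "finite A \<Longrightarrow> |A| \<le>o \<mu>"
  by (rule ordLess_imp_ordLeq[OF finite_less])

lemma underS_small: "|underS W x| \<le>o \<mu>"
proof (cases "x \<in> Field W")
  case True
  then have "|underS W x| <o cardSuc \<mu>"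
    using card_of_underS[OF card_W] succ ordLess_ordIso_trans by blast
  then show ?thesis using cardSuc_ordLeq_ordLess[OF Cmu card_of_Card_order] by blast
next
  case False
  then show ?thesis using underS_empty[OF False] finite_small[OF finite.emptyI] by simp
qed

lemma Field_big: "\<not> |Field W| \<le>o \<mu>"
proof
  assume "|Field W| \<le>o \<mu>"
  moreover have "cardSuc \<mu> =o |Field W|"
    using ordIso_transitive[OF card_of_Field_ordIso[OF card_W] succ] ordIso_symmetric by blast
  ultimately have "cardSuc \<mu> \<le>o \<mu>" using ordIso_ordLeq_trans by blast
  then show False using cardSuc_greater[OF Cmu] not_ordLess_ordLeq by blast
qed

lemma atMost_small: "|insert x (underS W x)| \<le>o \<mu>"
  using Un_Cinfinite_bound[OF finite_small[of "{x}"] underS_small Cinf] by simp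

lemma small_bounded:
  assumes "N \<subseteq> Field W" "|N| \<le>o \<mu>"
  obtains y where "y \<in> Field W" "\<forall>x \<in> N. x \<sqsubset> y"
proof -
  have "|\<Union>x\<in>N. insert x (underS W x)| \<le>o \<mu>"
    by (rule small_UN[OF Cinf assms(2) atMost_small])
  then obtain y where "y \<in> Field W" "y \<notin> (\<Union>x\<in>N. insert x (underS W x))"
    using big_not_covered[OF Field_big] by metis
  then show thesis using that less_total assms(1) by blast
qed

lemma big_unbounded:
  assumes "B \<subseteq> Field W" "\<not> |B| \<le>o \<mu>" "x \<in> Field W"
  obtains b where "b \<in> B" "x \<sqsubset> b"
proof -
  obtain b where "b \<in> B" "b \<notin> insert x (underS W x)"
    using big_not_covered[OF assms(2) atMost_small] by metis
  then show thesis using that less_total assms by blast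
qed

lemma no_max_mu:
  assumes "m \<in> Field \<mu>"
  obtains n where "n \<in> Field \<mu>" "m \<in> underS \<mu> n"
  using infinite_Card_order_limit[OF Cmu inf_mu assms] that Cmu unfolding underS_def by blast

lemma under_mu_less: "n \<in> Field \<mu> \<Longrightarrow> |under \<mu> n| <o \<mu>"
proof -
  assume "n \<in> Field \<mu>"
  then obtain k where k: "k \<in> Field \<mu>" "n \<in> underS \<mu> k" using no_max_mu by blast
  then have "under \<mu> n \<subseteq> underS \<mu> k"
    using wo_rel.TRANS[OF wo_mu] wo_rel.ANTISYM[OF wo_mu]
    unfolding under_def underS_def trans_def antisym_def by blast
  then show ?thesis
    using card_of_underS[OF Cmu k(1)] card_of_mono1 ordLeq_ordLess_trans by blast
qed

lemma below_mu_bounded: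
  assumes "K \<subseteq> Field \<mu>" "|K| <o \<mu>"
  obtains m where "m \<in> Field \<mu>" "\<forall>k \<in> K. (k, m) \<in> \<mu>"
proof -
  have "\<not> |K| =o \<mu>" using assms(2) not_ordLess_ordIso by blast
  then have "\<not> cofinal K \<mu>" using regular assms(1)
    unfolding regular_cardinal_def regularCard_def by blast
  then obtain m where m: "m \<in> Field \<mu>" "\<And>k. k \<in> K \<Longrightarrow> m = k \<or> (m, k) \<notin> \<mu>"
    unfolding cofinal_def by blast
  then have "(k, m) \<in> \<mu>" if "k \<in> K" for k
    using wo_rel.TOTALS[OF wo_mu] assms(1) that by blast
  then show thesis using m that by blast
qed

lemma big_above:
  assumes "\<not> |B| \<le>o \<mu>" "|A| \<le>o \<mu>"
  shows "|A| \<le>o |B|"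
proof -
  have "\<mu> <o |B|"
    using assms(1) not_ordLeq_iff_ordLess[OF _ card_of_Well_order] wo_mu
    unfolding wo_rel_def by metis
  then show ?thesis using assms(2) ordLeq_ordLess_trans ordLess_imp_ordLeq by metis
qed

lemma image_small: "|A| \<le>o \<mu> \<Longrightarrow> |f ` A| \<le>o \<mu>"
  using ordLeq_transitive[OF card_of_image] .

section \<open>Points whose levels are unbounded\<close>

definition fibre :: "'a set \<Rightarrow> 'a \<Rightarrow> 'm \<Rightarrow> 'a set" where
  "fibre B b n = {a \<in> B. b \<sqsubset> a \<and> e a b = n}"

definition unbounded_levels :: "'a set \<Rightarrow> 'a \<Rightarrow> bool" where
  "unbounded_levels B b \<longleftrightarrow> (\<forall>m \<in> Field \<mu>. \<exists>n. (m, n) \<in> \<mu> \<and> \<not> |fibre B b n| \<le>o \<mu>)"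

text \<open>
  If \<open>\<mu>\<^sup>+\<close> many \<open>b\<close> had bounded levels, \<open>\<mu>\<close> many of them would share a bound \<open>m\<close>. For each of
  these \<open>b\<close>, at most \<open>\<mu>\<close> many \<open>a \<in> B\<close> above \<open>b\<close> have \<open>e a b \<ge> m\<close>. So one \<open>a \<in> B\<close> above all of
  them satisfies \<open>e a b < m\<close> for all of them, and \<open>e a\<close> injects a set of cardinality \<open>\<mu>\<close> into
  the predecessors of \<open>m\<close>.
\<close>

lemma few_bounded_levels:
  assumes B: "B \<subseteq> Field W" "\<not> |B| \<le>o \<mu>"
  shows "|{b \<in> Field W. \<not> unbounded_levels B b}| \<le>o \<mu>"
proof (rule ccontr)
  define N where "N = {b \<in> Field W. \<not> unbounded_levels B b}"
  assume "\<not> |{b \<in> Field W. \<not> unbounded_levels B b}| \<le>o \<mu>"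
  then have big: "\<not> |N| \<le>o \<mu>" unfolding N_def .
  have "\<exists>m. m \<in> Field \<mu> \<and> (\<forall>n. (m, n) \<in> \<mu> \<longrightarrow> |fibre B b n| \<le>o \<mu>)" if "b \<in> N" for b
    using that unfolding N_def unbounded_levels_def by blast
  then obtain f where f: "\<And>b. b \<in> N \<Longrightarrow> f b \<in> Field \<mu>"
    "\<And>b n. b \<in> N \<Longrightarrow> (f b, n) \<in> \<mu> \<Longrightarrow> |fibre B b n| \<le>o \<mu>" by metis
  obtain m where m: "m \<in> Field \<mu>" "\<not> |{b \<in> N. f b = m}| \<le>o \<mu>"
    using big_fibre[OF Cinf card_mu big, of f] f(1) by blast
  have "|Field \<mu>| \<le>o |{b \<in> N. f b = m}|" using big_above[OF m(2) card_mu] .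
  then obtain g where g: "inj_on g (Field \<mu>)" "g ` Field \<mu> \<subseteq> {b \<in> N. f b = m}"
    using card_of_ordLeq by metis
  define G where "G = g ` Field \<mu>"
  have G_small: "|G| \<le>o \<mu>" unfolding G_def
    using image_small[OF card_mu] .
  have G: "b \<in> N" "f b = m" if "b \<in> G" for b using g(2) that unfolding G_def by blast+
  \<comment> \<open>the elements not above \<open>G\<close>, and those coded by at least \<open>m\<close> for some \<open>b \<in> G\<close>\<close>
  have "|\<Union>b\<in>G. insert b (underS W b) \<union> (\<Union>n\<in>Field \<mu>. if (m, n) \<in> \<mu> then fibre B b n else {})| \<le>o \<mu>"
    (is "|?U| \<le>o _")
  proof (rule small_UN[OF Cinf G_small], rule Un_Cinfinite_bound[OF atMost_small _ Cinf],
      rule small_UN[OF Cinf card_mu])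
    fix b n assume b: "b \<in> G"
    show "|if (m, n) \<in> \<mu> then fibre B b n else {}| \<le>o \<mu>"
      using f(2)[OF G(1)[OF b], unfolded G(2)[OF b]] finite_small by auto
  qed
  from big_not_covered[OF B(2) this] obtain a where a: "a \<in> B" "a \<notin> ?U" .
  have lt: "b \<sqsubset> a" if "b \<in> G" for b
    using a less_total[of b a] G[OF that] that B(1) unfolding N_def by blast
  have low: "e a b \<in> under \<mu> m" if b: "b \<in> G" for b
  proof -
    have eF: "e a b \<in> Field \<mu>" using range_e[OF lt[OF b]] .
    have "a \<in> fibre B b (e a b)" using lt[OF b] a(1) unfolding fibre_def by blast
    then have "(m, e a b) \<notin> \<mu>" using a(2) b eF by auto
    then show ?thesis using wo_rel.TOTALS[OF wo_mu] m(1) eF unfolding under_def by blast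
  qed
  have "a \<in> Field W" using a(1) B(1) by blast
  then have "inj_on (e a) G" using inj_e lt by (meson inj_on_subset subsetI)
  then have "|G| \<le>o |under \<mu> m|"
    using low card_of_ordLeq by (metis image_subsetI)
  moreover have "|Field \<mu>| \<le>o |G|" using g(1) card_of_ordLeq unfolding G_def by blast
  ultimately have "|Field \<mu>| \<le>o |under \<mu> m|" using ordLeq_transitive by metis
  then have "|Field \<mu>| <o \<mu>" using ordLeq_ordLess_trans under_mu_less[OF m(1)] by metis
  then show False using card_of_Field_ordIso[OF Cmu] not_ordLess_ordIso by metis
qed

section \<open>Common limits of cofinality \<open>\<mu>\<close>\<close>

text \<open>
  The condition on \<open>F\<close> expresses that \<open>g\<close> is a limit ordinal of cofinality at least \<open>\<mu>\<close>. The case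
  \<open>F = {}\<close> excludes the least element.
\<close>

definition mu_limit :: "'a set set \<Rightarrow> 'a \<Rightarrow> bool" where
  "mu_limit \<D> g \<longleftrightarrow> g \<in> Field W \<and>
     (\<forall>D \<in> \<D>. \<forall>a. a \<sqsubset> g \<longrightarrow> (\<exists>d \<in> D. a \<sqsubset> d \<and> d \<sqsubset> g)) \<and>
     (\<forall>F. F \<subseteq> underS W g \<longrightarrow> |F| <o \<mu> \<longrightarrow> (\<exists>a. a \<sqsubset> g \<and> (\<forall>x \<in> F. x \<sqsubset> a)))"

lemma mu_limit_between:
  "mu_limit \<D> g \<Longrightarrow> D \<in> \<D> \<Longrightarrow> a \<sqsubset> g \<Longrightarrow> \<exists>d \<in> D. a \<sqsubset> d \<and> d \<sqsubset> g"
  unfolding mu_limit_def by simp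

lemma mu_limit_bound:
  "mu_limit \<D> g \<Longrightarrow> F \<subseteq> underS W g \<Longrightarrow> |F| <o \<mu> \<Longrightarrow> \<exists>a. a \<sqsubset> g \<and> (\<forall>x \<in> F. x \<sqsubset> a)"
  unfolding mu_limit_def by simp

lemma mu_limit_mono: "mu_limit \<D> g \<Longrightarrow> \<E> \<subseteq> \<D> \<Longrightarrow> mu_limit \<E> g"
  unfolding mu_limit_def by (elim conjE, intro conjI) (assumption, blast, assumption)

definition big_family :: "'a set set \<Rightarrow> bool" where
  "big_family \<D> \<longleftrightarrow> |\<D>| \<le>o \<mu> \<and> (\<forall>D \<in> \<D>. D \<subseteq> Field W \<and> \<not> |D| \<le>o \<mu>)"

text \<open>
  The limit is the supremum of a \<open>\<mu>\<close>-sequence that jumps over an element of every member of \<open>\<D>\<close>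
  at each step. Regularity of \<open>\<mu>\<close> bounds, below the supremum, sets of fewer than \<open>\<mu>\<close> elements.
\<close>

lemma mu_limit_exists:
  assumes "big_family \<D>"
  shows "\<exists>g. mu_limit \<D> g"
proof -
  let ?P = "\<lambda>N z. z \<in> Field W \<and> (\<forall>x \<in> N. x \<sqsubset> z \<and> (\<forall>D \<in> \<D>. \<exists>d \<in> D. x \<sqsubset> d \<and> d \<sqsubset> z))"
  have ex: "\<exists>z. ?P N z" if N: "N \<subseteq> Field W" "|N| \<le>o \<mu>" for N
  proof -
    have "\<exists>d. d \<in> D \<and> x \<sqsubset> d" if D: "D \<in> \<D>" and x: "x \<in> Field W" for D x
    proof -
      have "D \<subseteq> Field W" "\<not> |D| \<le>o \<mu>" using assms D unfolding big_family_def by simp_all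
      from big_unbounded[OF this x] show ?thesis by blast
    qed
    then obtain d where d: "\<And>D x. D \<in> \<D> \<Longrightarrow> x \<in> Field W \<Longrightarrow> d D x \<in> D \<and> x \<sqsubset> d D x" by metis
    have sm: "|N \<union> (\<Union>D\<in>\<D>. d D ` N)| \<le>o \<mu>"
      using assms unfolding big_family_def
      by (intro Un_Cinfinite_bound[OF N(2) _ Cinf] small_UN[OF Cinf] image_small[OF N(2)]) simp
    have "N \<union> (\<Union>D\<in>\<D>. d D ` N) \<subseteq> Field W"
      using N(1) d less_Field by blast
    from small_bounded[OF this sm] obtain z
      where z: "z \<in> Field W" "\<forall>x \<in> N \<union> (\<Union>D\<in>\<D>. d D ` N). x \<sqsubset> z" .
    have "x \<sqsubset> z \<and> (\<forall>D \<in> \<D>. \<exists>d \<in> D. x \<sqsubset> d \<and> d \<sqsubset> z)" if "x \<in> N" for x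
    proof (intro conjI ballI)
      show "x \<sqsubset> z" using z(2) that by blast
      fix D assume "D \<in> \<D>"
      then have "d D x \<in> D \<and> x \<sqsubset> d D x" "d D x \<sqsubset> z" using d z(2) that N(1) by blast+
      then show "\<exists>d \<in> D. x \<sqsubset> d \<and> d \<sqsubset> z" by blast
    qed
    then show ?thesis using z(1) by blast
  qed
  define bnd where "bnd N = (SOME z. ?P N z)" for N
  have bnd: "?P N (bnd N)" if "N \<subseteq> Field W" "|N| \<le>o \<mu>" for N
    unfolding bnd_def using someI_ex[OF ex[OF that]] .
  define a where "a = wfrec (\<mu> - Id) (\<lambda>f m. bnd (f ` underS \<mu> m))"
  have a_eq: "a m = bnd (a ` underS \<mu> m)" for m
  proof -
    have "a m = bnd (cut a (\<mu> - Id) m ` underS \<mu> m)"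
      unfolding a_def by (subst wfrec[OF wo_rel.WF[OF wo_mu]]) rule
    moreover have "cut a (\<mu> - Id) m ` underS \<mu> m = a ` underS \<mu> m"
      unfolding cut_def underS_def by (auto intro!: image_cong)
    ultimately show ?thesis by simp
  qed
  have small: "|a ` underS \<mu> m| \<le>o \<mu>" for m
    using image_small[OF small_subset[OF Order_Relation.underS_Field card_mu]] .
  have aF: "a m \<in> Field W" for m
  proof (induction m rule: wf_induct_rule[OF wo_rel.WF[OF wo_mu]])
    case (1 m)
    then have "a ` underS \<mu> m \<subseteq> Field W" unfolding underS_def by blast
    then show ?case using bnd[OF _ small] a_eq by metis
  qed
  have step: "a k \<sqsubset> a m \<and> (\<forall>D \<in> \<D>. \<exists>d \<in> D. a k \<sqsubset> d \<and> d \<sqsubset> a m)" if "k \<in> underS \<mu> m" for k m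
    using bnd[OF _ small[of m]] aF that unfolding a_eq[of m, symmetric] by blast
  have "a ` Field \<mu> \<subseteq> Field W" using aF by blast
  from small_bounded[OF this image_small[OF card_mu]]
  obtain y where "y \<in> Field W" "\<forall>x \<in> a ` Field \<mu>. x \<sqsubset> y" .
  then have y: "y \<in> {y \<in> Field W. \<forall>m \<in> Field \<mu>. a m \<sqsubset> y}" by blast
  obtain g where "g \<in> {y \<in> Field W. \<forall>m \<in> Field \<mu>. a m \<sqsubset> y}"
    "\<And>x. x \<sqsubset> g \<Longrightarrow> x \<notin> {y \<in> Field W. \<forall>m \<in> Field \<mu>. a m \<sqsubset> y}"
    using less_minimal[OF y] by blast
  then have g: "g \<in> Field W" "\<And>m. m \<in> Field \<mu> \<Longrightarrow> a m \<sqsubset> g"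
    "\<And>x. x \<sqsubset> g \<Longrightarrow> \<exists>m \<in> Field \<mu>. \<not> a m \<sqsubset> x" using less_Field by blast+
  have above: "\<exists>m \<in> Field \<mu>. x \<sqsubset> a m" if x: "x \<sqsubset> g" for x
  proof -
    obtain m where m: "m \<in> Field \<mu>" "\<not> a m \<sqsubset> x" using g(3)[OF x] by blast
    obtain n where n: "n \<in> Field \<mu>" "m \<in> underS \<mu> n" using no_max_mu[OF m(1)] by blast
    have "x = a m \<or> x \<sqsubset> a m" using less_total[of "a m" x] m(2) aF less_Field[OF x] by blast
    then have "x \<sqsubset> a n" using step[OF n(2)] less_trans by blast
    then show ?thesis using n(1) by blast
  qed
  have "\<exists>d \<in> D. x \<sqsubset> d \<and> d \<sqsubset> g" if "D \<in> \<D>" "x \<sqsubset> g" for D x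
  proof -
    obtain m where m: "m \<in> Field \<mu>" "x \<sqsubset> a m" using above[OF \<open>x \<sqsubset> g\<close>] by blast
    obtain n where n: "n \<in> Field \<mu>" "m \<in> underS \<mu> n" using no_max_mu[OF m(1)] by blast
    show ?thesis using step[OF n(2)] \<open>D \<in> \<D>\<close> m(2) g(2)[OF n(1)] less_trans by meson
  qed
  moreover have "\<exists>z. z \<sqsubset> g \<and> (\<forall>x \<in> F. x \<sqsubset> z)" if F: "F \<subseteq> underS W g" "|F| <o \<mu>" for F
  proof -
    have "\<forall>x \<in> F. \<exists>m. m \<in> Field \<mu> \<and> x \<sqsubset> a m" using above F(1) by blast
    then obtain p where p: "\<And>x. x \<in> F \<Longrightarrow> p x \<in> Field \<mu> \<and> x \<sqsubset> a (p x)" by metis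
    have "p ` F \<subseteq> Field \<mu>" using p by blast
    from below_mu_bounded[OF this ordLeq_ordLess_trans[OF card_of_image F(2)]]
    obtain m where m: "m \<in> Field \<mu>" "\<forall>k \<in> p ` F. (k, m) \<in> \<mu>" .
    have "x \<sqsubset> a m" if "x \<in> F" for x
    proof (cases "p x = m")
      case True then show ?thesis using p[OF that] by simp
    next
      case False
      then have "p x \<in> underS \<mu> m" using m(2) that unfolding underS_def by blast
      then show ?thesis using step p[OF that] less_trans by blast
    qed
    then show ?thesis using g(2)[OF m(1)] by blast
  qed
  ultimately show ?thesis unfolding mu_limit_def using g(1) by blast
qed

section \<open>Positive sets and Ulam's partition\<close>

text \<open>
  The non-positive sets play the part of the nonstationary ideal. Testing with arbitrary big
  families instead of clubs makes completeness of the ideal immediate: families witnessing that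
  \<open>\<mu>\<close> many sets are not positive have a big family as their union.
\<close>

definition mu_positive :: "'a set \<Rightarrow> bool" where
  "mu_positive S \<longleftrightarrow> (\<forall>\<D>. big_family \<D> \<longrightarrow> (\<exists>g \<in> S. mu_limit \<D> g))"

lemma positive_mono: "mu_positive S \<Longrightarrow> S \<subseteq> T \<Longrightarrow> mu_positive T"
  unfolding mu_positive_def by blast

text \<open>
  Adding the tail itself to the family forces every common limit into the tail.
\<close>

lemma positive_tail:
  assumes "x \<in> Field W"
  shows "mu_positive {g. x \<sqsubset> g}"
  unfolding mu_positive_def
proof (intro allI impI)
  fix \<D> assume D: "big_family \<D>"
  let ?T = "{g \<in> Field W. x \<sqsubset> g}"
  have cover: "Field W \<subseteq> ?T \<union> insert x (underS W x)" using less_total assms by blast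
  have "\<not> |?T| \<le>o \<mu>"
  proof
    assume "|?T| \<le>o \<mu>"
    from small_subset[OF cover Un_Cinfinite_bound[OF this atMost_small Cinf]]
    show False using Field_big by contradiction
  qed
  moreover have "|insert ?T \<D>| \<le>o \<mu>"
    using Un_Cinfinite_bound[OF finite_small[of "{?T}"] _ Cinf, of \<D>] D
    unfolding big_family_def by simp
  ultimately have "big_family (insert ?T \<D>)" using D unfolding big_family_def by simp
  then obtain g where g: "mu_limit (insert ?T \<D>) g" using mu_limit_exists by blast
  obtain a where "a \<sqsubset> g"
    using mu_limit_bound[OF g empty_subsetI finite_less[OF finite.emptyI]] by blast
  then obtain d where "x \<sqsubset> d" "d \<sqsubset> g" using mu_limit_between[OF g insertI1] by blast
  then have "x \<sqsubset> g" by (rule less_trans)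
  moreover have "mu_limit \<D> g" using mu_limit_mono[OF g] by blast
  ultimately show "\<exists>g \<in> {g. x \<sqsubset> g}. mu_limit \<D> g" by blast
qed

lemma positive_UN:
  assumes "|I| \<le>o \<mu>" "mu_positive (\<Union>i\<in>I. S i)"
  obtains i where "i \<in> I" "mu_positive (S i)"
proof (rule ccontr)
  assume "\<not> thesis"
  then have "\<forall>i \<in> I. \<exists>\<D>. big_family \<D> \<and> (\<forall>g \<in> S i. \<not> mu_limit \<D> g)"
    using that unfolding mu_positive_def by blast
  then obtain D where D: "\<And>i. i \<in> I \<Longrightarrow> big_family (D i)"
    "\<And>i g. i \<in> I \<Longrightarrow> g \<in> S i \<Longrightarrow> \<not> mu_limit (D i) g" by metis
  have "|\<Union>i\<in>I. D i| \<le>o \<mu>"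
    using D(1) unfolding big_family_def by (intro small_UN[OF Cinf assms(1)]) simp
  then have "big_family (\<Union>i\<in>I. D i)"
    using D(1) unfolding big_family_def by simp
  then obtain i g where "i \<in> I" "g \<in> S i" "mu_limit (\<Union>i\<in>I. D i) g"
    using assms(2) unfolding mu_positive_def by blast
  moreover from this have "mu_limit (D i) g" by (elim mu_limit_mono) blast
  ultimately show False using D(2) by blast
qed

text \<open>
  Ulam's matrix argument. For every \<open>x\<close> the tail above \<open>x\<close> splits into the \<open>\<mu>\<close> sets
  \<open>{g. x < g, e g x = n}\<close>, one of which is positive. The same \<open>n\<close> serves for \<open>\<mu>\<^sup>+\<close> many \<open>x\<close>, and
  for fixed \<open>n\<close> the sets for different \<open>x\<close> are disjoint, because \<open>e g\<close> is injective.
\<close>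

lemma positive_partition:
  assumes "|I| \<le>o \<mu>"
  obtains q :: "'a \<Rightarrow> 'i" where "\<And>i. i \<in> I \<Longrightarrow> mu_positive {g. q g = i}"
proof -
  let ?U = "\<lambda>x n. {g. x \<sqsubset> g \<and> e g x = n}"
  have "\<exists>n. n \<in> Field \<mu> \<and> mu_positive (?U x n)" if "x \<in> Field W" for x
  proof -
    have "{g. x \<sqsubset> g} \<subseteq> (\<Union>n\<in>Field \<mu>. ?U x n)" using range_e by blast
    then have "mu_positive (\<Union>n\<in>Field \<mu>. ?U x n)" using positive_tail[OF that] positive_mono by blast
    from positive_UN[OF card_mu this] show ?thesis by blast
  qed
  then obtain p where p: "\<And>x. x \<in> Field W \<Longrightarrow> p x \<in> Field \<mu> \<and> mu_positive (?U x (p x))" by metis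
  have "p ` Field W \<subseteq> Field \<mu>" using p by blast
  from big_fibre[OF Cinf card_mu Field_big this]
  obtain n where n: "\<not> |{x \<in> Field W. p x = n}| \<le>o \<mu>" .
  let ?X = "{x \<in> Field W. p x = n}"
  have "|I| \<le>o |?X|" using big_above[OF n assms] .
  then obtain s where s: "inj_on s I" "s ` I \<subseteq> ?X" using card_of_ordLeq by metis
  define q where "q g = (SOME i. i \<in> I \<and> s i \<sqsubset> g \<and> e g (s i) = n)" for g
  have q: "q g = i" if "i \<in> I" "g \<in> ?U (s i) n" for i g
  proof -
    have "q g \<in> I \<and> s (q g) \<sqsubset> g \<and> e g (s (q g)) = n"
      unfolding q_def by (rule someI[of _ i]) (use that in blast)
    moreover from this have "s (q g) = s i"
      using inj_onD[OF inj_e[of g]] less_Field that by auto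
    ultimately show ?thesis using s(1) that(1) by (auto dest: inj_onD)
  qed
  have "mu_positive {g. q g = i}" if i: "i \<in> I" for i
  proof -
    have "mu_positive (?U (s i) n)" using p s(2) i by force
    then show ?thesis by (rule positive_mono) (use q[OF i] in blast)
  qed
  then show thesis using that by blast
qed

section \<open>The colouring\<close>

text \<open>
  The least element \<open>g\<close> of the interval \<open>[a, b)\<close> with \<open>e b g \<le> n\<close>.
\<close>

definition next_low :: "'a \<Rightarrow> 'm \<Rightarrow> 'a \<Rightarrow> 'a" where
  "next_low b n a = (THE g. g \<sqsubset> b \<and> (e b g, n) \<in> \<mu> \<and> \<not> g \<sqsubset> a \<and>
     (\<forall>x. x \<sqsubset> g \<longrightarrow> (e b x, n) \<in> \<mu> \<longrightarrow> x \<sqsubset> a))"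

lemma next_low_eq:
  assumes "g \<sqsubset> b" "(e b g, n) \<in> \<mu>" "a \<sqsubset> g" "\<And>x. x \<sqsubset> g \<Longrightarrow> (e b x, n) \<in> \<mu> \<Longrightarrow> x \<sqsubset> a"
  shows "next_low b n a = g"
  unfolding next_low_def
proof (rule the_equality)
  show "g \<sqsubset> b \<and> (e b g, n) \<in> \<mu> \<and> \<not> g \<sqsubset> a \<and> (\<forall>x. x \<sqsubset> g \<longrightarrow> (e b x, n) \<in> \<mu> \<longrightarrow> x \<sqsubset> a)"
    using assms less_trans less_irrefl by blast
next
  fix k assume k: "k \<sqsubset> b \<and> (e b k, n) \<in> \<mu> \<and> \<not> k \<sqsubset> a \<and> (\<forall>x. x \<sqsubset> k \<longrightarrow> (e b x, n) \<in> \<mu> \<longrightarrow> x \<sqsubset> a)"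
  show "k = g"
    using less_total[of k g] less_Field assms k less_trans less_irrefl by blast
qed

text \<open>
  The pair \<open>y = (b, c)\<close> is found as follows. First \<open>c\<close> is chosen outside the small exceptional sets
  of all \<open>B i\<close>. This determines the family \<open>\<D>\<close> of all big sets \<open>{a \<in> B i. e a c = n}\<close>. For
  every colour \<open>j\<close> there is a common limit \<open>g j\<close> of \<open>\<D>\<close> with that colour, and \<open>b\<close> is any upper
  bound of the points \<open>g j\<close>. So one pair serves all \<open>i\<close> and \<open>j\<close> at once.
\<close>

theorem onto_colouring:
  assumes I: "|I| \<le>o \<mu>"
  obtains col :: "'a \<Rightarrow> 'a \<times> 'a \<Rightarrow> 'i"
  where "\<And>J B. J \<subseteq> I \<Longrightarrow> (\<And>i. i \<in> J \<Longrightarrow> B i \<subseteq> Field W \<and> \<not> |B i| \<le>o \<mu>) \<Longrightarrow>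
     \<exists>y \<in> Field W \<times> Field W. \<forall>i \<in> J. \<forall>j \<in> I. \<exists>a \<in> B i. col a y = j"
proof -
  obtain q :: "'a \<Rightarrow> 'i" where q: "\<And>i. i \<in> I \<Longrightarrow> mu_positive {g. q g = i}"
    using positive_partition[OF I] by blast
  define col where "col a y = q (next_low (fst y) (e a (snd y)) a)" for a y
  have "\<exists>y \<in> Field W \<times> Field W. \<forall>i \<in> J. \<forall>j \<in> I. \<exists>a \<in> B i. col a y = j"
    if J: "J \<subseteq> I" and B: "\<And>i. i \<in> J \<Longrightarrow> B i \<subseteq> Field W \<and> \<not> |B i| \<le>o \<mu>" for J and B :: "'i \<Rightarrow> 'a set"
  proof -
    have J_small: "|J| \<le>o \<mu>" using small_subset[OF J I] .
    have "|\<Union>i\<in>J. {b \<in> Field W. \<not> unbounded_levels (B i) b}| \<le>o \<mu>"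
      using B by (intro small_UN[OF Cinf J_small] few_bounded_levels) simp_all
    from big_not_covered[OF Field_big this]
    obtain c where c: "c \<in> Field W" "c \<notin> (\<Union>i\<in>J. {b \<in> Field W. \<not> unbounded_levels (B i) b})" .
    define \<D> where "\<D> = {D \<in> (\<lambda>(i, n). fibre (B i) c n) ` (J \<times> Field \<mu>). \<not> |D| \<le>o \<mu>}"
    have "|J \<times> Field \<mu>| \<le>o \<mu>"
      using card_of_Times_ordLeq_infinite_Field[OF inf_mu J_small card_mu Cmu] .
    from image_small[OF this] have "|\<D>| \<le>o \<mu>"
      unfolding \<D>_def by (rule small_subset[rotated]) blast
    then have D: "big_family \<D>"
      using B unfolding big_family_def \<D>_def fibre_def by blast
    then have "\<forall>j \<in> I. \<exists>g. q g = j \<and> mu_limit \<D> g" using q unfolding mu_positive_def by blast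
    then obtain g where g: "\<And>j. j \<in> I \<Longrightarrow> q (g j) = j \<and> mu_limit \<D> (g j)" by metis
    have "g ` I \<subseteq> Field W" using g unfolding mu_limit_def by blast
    from small_bounded[OF this image_small[OF I]]
    obtain b where b: "b \<in> Field W" "\<forall>x \<in> g ` I. x \<sqsubset> b" .
    have "\<exists>a \<in> B i. col a (b, c) = j" if i: "i \<in> J" and j: "j \<in> I" for i j
    proof -
      have gb: "g j \<sqsubset> b" using b j by blast
      obtain n where n: "(e b (g j), n) \<in> \<mu>" "\<not> |fibre (B i) c n| \<le>o \<mu>"
        using c i range_e[OF gb] unfolding unbounded_levels_def by blast
      then have nF: "n \<in> Field \<mu>" unfolding Field_def by blast
      then have D: "fibre (B i) c n \<in> \<D>" using n(2) i unfolding \<D>_def by auto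
      \<comment> \<open>the competitors of \<open>g j\<close> as the next element with code at most \<open>n\<close>\<close>
      let ?F = "{x. x \<sqsubset> g j \<and> (e b x, n) \<in> \<mu>}"
      have "inj_on (e b) ?F"
        using inj_e[OF b(1)] by (rule inj_on_subset) (use gb less_trans in blast)
      then have "|?F| \<le>o |under \<mu> n|" by (rule card_of_ordLeqI) (simp add: under_def)
      from ordLeq_ordLess_trans[OF this under_mu_less[OF nF]] have "|?F| <o \<mu>" .
      then obtain z where z: "z \<sqsubset> g j" "\<And>x. x \<in> ?F \<Longrightarrow> x \<sqsubset> z"
        using mu_limit_bound[OF conjunct2[OF g[OF j]], of ?F] by blast
      obtain a where a: "a \<in> fibre (B i) c n" "z \<sqsubset> a" "a \<sqsubset> g j"
        using mu_limit_between[OF conjunct2[OF g[OF j]] D z(1)] by blast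
      have "next_low b n a = g j"
        using gb n(1) a(3) z(2) a(2) less_trans by (intro next_low_eq) blast+
      then have "col a (b, c) = j" using a(1) g[OF j] unfolding col_def fibre_def by simp
      then show ?thesis using a(1) unfolding fibre_def by blast
    qed
    then show ?thesis using b(1) c(1) by blast
  qed
  then show thesis using that[of col] by blast
qed

end

section \<open>Functions without a representation\<close>

text \<open>
  Since \<open>\<mu> < \<cc>\<close>, both \<open>\<mu>\<^sup>+\<close> and \<open>\<mu>\<^sup>+ \<times> \<mu>\<^sup>+\<close> embed into \<open>\<real>\<close>. On the images the function \<open>f\<close>
  takes the value omitted by \<open>h\<close> on the rectangle whose index is the colour.
\<close>

lemma unrepresentable_if_rectangle_cover:
  fixes \<mu> :: "'m rel" and h :: "'p \<times> 'q \<Rightarrow> real"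
    and \<A> :: "'i \<Rightarrow> 'p set" and \<B> :: "'i \<Rightarrow> 'q set"
  assumes \<mu>: "regular_cardinal \<mu>" "\<mu> <o continuum"
    and I: "|I| \<le>o \<mu>"
    and cover: "\<And>p q. \<exists>i \<in> I. p \<in> \<A> i \<and> q \<in> \<B> i"
    and miss: "\<And>i. i \<in> I \<Longrightarrow> h ` (\<A> i \<times> \<B> i) \<noteq> UNIV"
  obtains f :: "real \<times> real \<Rightarrow> real"
  where "\<And>G\<^sub>0 G\<^sub>1. \<exists>x y. f (x, y) \<noteq> h (G\<^sub>0 x, G\<^sub>1 y)"
proof -
  have Cmu: "Card_order \<mu>" and Cinf: "Cinfinite \<mu>" using \<mu>(1) unfolding regular_cardinal_def by auto
  define W where "W = cardSuc \<mu>"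
  have CW: "Card_order W" unfolding W_def by (rule cardSuc_Card_order[OF Cmu])
  have "\<exists>g. inj_on g (underS W x) \<and> g ` underS W x \<subseteq> Field \<mu>" if "x \<in> Field W" for x
  proof -
    have "|underS W x| \<le>o \<mu>"
      using cardSuc_ordLeq_ordLess[OF Cmu card_of_Card_order, THEN iffD1,
          OF card_of_underS[OF CW that, unfolded W_def]] unfolding W_def .
    from ordLeq_ordIso_trans[OF this ordIso_symmetric[OF card_of_Field_ordIso[OF Cmu]]]
    have "|underS W x| \<le>o |Field \<mu>|" .
    then show ?thesis using card_of_ordLeq by metis
  qed
  then obtain e where e: "\<And>x. x \<in> Field W \<Longrightarrow> inj_on (e x) (underS W x) \<and> e x ` underS W x \<subseteq> Field \<mu>"
    by metis
  interpret regular_successor \<mu> W e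
  proof
    show "W =o cardSuc \<mu>" unfolding W_def using ordIso_refl[OF cardSuc_Card_order[OF Cmu]] .
    show "e x y \<in> Field \<mu>" if "y \<in> underS W x" for x y
    proof -
      have "x \<in> Field W" using that unfolding underS_def Field_def by blast
      then show ?thesis using e that by blast
    qed
  qed (use \<mu> CW e in blast)+
  obtain col where col: "\<And>J B. J \<subseteq> I \<Longrightarrow> (\<And>i. i \<in> J \<Longrightarrow> B i \<subseteq> Field W \<and> \<not> |B i| \<le>o \<mu>) \<Longrightarrow>
     \<exists>y \<in> Field W \<times> Field W. \<forall>i \<in> J. \<forall>j \<in> I. \<exists>a \<in> B i. col a y = j"
    using onto_colouring[OF I] by blast
  have "W \<le>o continuum"
    unfolding W_def using cardSuc_least[OF Cmu card_of_Card_order \<mu>(2)] .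
  then have WR: "|Field W| \<le>o continuum"
    using ordIso_ordLeq_trans[OF card_of_Field_ordIso[OF CW]] by blast
  obtain u :: "'m set \<Rightarrow> real" where u: "inj_on u (Field W)"
    using card_of_ordLeq[THEN iffD2, OF WR] by blast
  have WWR: "|Field W \<times> Field W| \<le>o continuum"
    by (rule card_of_Times_ordLeq_infinite_Field[OF _ WR WR card_of_Card_order])
      (simp add: Field_card_of infinite_UNIV_char_0)
  obtain v :: "'m set \<times> 'm set \<Rightarrow> real" where v: "inj_on v (Field W \<times> Field W)"
    using card_of_ordLeq[THEN iffD2, OF WWR] by blast
  have "\<exists>c. c \<notin> h ` (\<A> i \<times> \<B> i)" if "i \<in> I" for i using miss[OF that] by blast
  then obtain c where c: "\<And>i. i \<in> I \<Longrightarrow> c i \<notin> h ` (\<A> i \<times> \<B> i)" by metis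
  define f where "f = (\<lambda>(x, y). c (col (inv_into (Field W) u x) (inv_into (Field W \<times> Field W) v y)))"
  have f: "f (u a, v y) = c (col a y)" if "a \<in> Field W" "y \<in> Field W \<times> Field W" for a y
    unfolding f_def using inv_into_f_f[OF u that(1)] inv_into_f_f[OF v that(2)] by simp
  have "\<exists>x y. f (x, y) \<noteq> h (G\<^sub>0 x, G\<^sub>1 y)" for G\<^sub>0 G\<^sub>1
  proof (rule ccontr)
    assume "\<nexists>x y. f (x, y) \<noteq> h (G\<^sub>0 x, G\<^sub>1 y)"
    then have G: "f (x, y) = h (G\<^sub>0 x, G\<^sub>1 y)" for x y by blast
    \<comment> \<open>the colouring theorem applies to the big \<open>B i\<close> only; the small ones are avoided by \<open>a\<close> below\<close>
    define B where "B i = {a \<in> Field W. G\<^sub>0 (u a) \<in> \<A> i}" for i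
    define J where "J = {i \<in> I. \<not> |B i| \<le>o \<mu>}"
    obtain y where y: "y \<in> Field W \<times> Field W" "\<forall>i \<in> J. \<forall>j \<in> I. \<exists>a \<in> B i. col a y = j"
      using col[of J B] unfolding J_def B_def by blast
    have "|\<Union>i\<in>I - J. B i| \<le>o \<mu>"
      by (rule small_UN[OF Cinf small_subset[OF Diff_subset I]]) (simp add: J_def)
    from big_not_covered[OF Field_big this] obtain a where a: "a \<in> Field W" "a \<notin> (\<Union>i\<in>I - J. B i)" .
    obtain i where i: "i \<in> I" "G\<^sub>0 (u a) \<in> \<A> i" "G\<^sub>1 (v y) \<in> \<B> i" using cover by blast
    then have "i \<in> J" using a unfolding B_def by blast
    then obtain a' where a': "a' \<in> B i" "col a' y = i" using y(2) i(1) by blast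
    then have "c i = h (G\<^sub>0 (u a'), G\<^sub>1 (v y))" using f[OF _ y(1)] G unfolding B_def by force
    then show False using c[OF i(1)] a'(1) i(3) unfolding B_def by blast
  qed
  then show thesis using that by blast
qed

lemma Da_representation:
  fixes f :: "real \<times> real \<Rightarrow> real"
  assumes "Da h"
  obtains G\<^sub>0 G\<^sub>1 where "\<forall>x y. f (x, y) = h (G\<^sub>0 x, G\<^sub>1 y)"
proof -
  obtain g\<^sub>0 g\<^sub>1 :: "nat \<Rightarrow> real \<Rightarrow> real" where g: "\<forall>x y. f (x, y) = h (\<lambda>n. g\<^sub>0 n x, \<lambda>n. g\<^sub>1 n y)"
    using assms[unfolded Da_def, rule_format, of f] by blast
  show thesis by (rule that[of "\<lambda>x n. g\<^sub>0 n x" "\<lambda>y n. g\<^sub>1 n y"]) (use g in simp)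
qed

lemma n_cover_1_point:
  assumes "n_cover 1 \<C>"
  shows "\<exists>A \<in> \<C>. p \<in> A"
  using assms[unfolded n_cover_def, rule_format, of "{p}"] by simp

text \<open>
  The rows of \<open>f\<close> are indexed by the members of \<open>\<B>\<close> themselves and its columns run through all
  functions \<open>\<B> \<rightarrow> \<real>\<close>. For \<open>b \<in> \<B>\<close> the first coordinate of row \<open>b\<close> lies in some \<open>a b \<in> \<A>\<close>, and
  \<open>h\<close> omits a value \<open>c b\<close> on \<open>a b \<times> b\<close>. The column \<open>c\<close> is mapped into some \<open>b \<in> \<B>\<close>, and its entry
  in row \<open>b\<close> is the omitted value \<open>c b\<close>.
\<close>

lemma Da_fails_if_columns_enumerable:
  fixes h :: "(nat \<Rightarrow> real) \<times> (nat \<Rightarrow> real) \<Rightarrow> real"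
  assumes A: "n_cover 1 \<A>" and B: "n_cover 1 \<B>"
    and miss: "\<And>A B. A \<in> \<A> \<Longrightarrow> B \<in> \<B> \<Longrightarrow> h ` (A \<times> B) \<noteq> UNIV"
    and \<B>: "|\<B>| \<le>o continuum" "|Func \<B> (UNIV :: real set)| \<le>o continuum"
  shows "\<not> Da h"
proof
  assume Da: "Da h"
  obtain u :: "(nat \<Rightarrow> real) set \<Rightarrow> real" where u: "inj_on u \<B>"
    using card_of_ordLeq[THEN iffD2, OF \<B>(1)] by blast
  obtain w :: "((nat \<Rightarrow> real) set \<Rightarrow> real) \<Rightarrow> real" where w: "inj_on w (Func \<B> UNIV)"
    using card_of_ordLeq[THEN iffD2, OF \<B>(2)] by blast
  define f where "f = (\<lambda>(x, y). inv_into (Func \<B> UNIV) w y (inv_into \<B> u x))"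
  obtain G\<^sub>0 G\<^sub>1 where G: "\<forall>x y. f (x, y) = h (G\<^sub>0 x, G\<^sub>1 y)" by (rule Da_representation[OF Da, of f])
  have "\<exists>A c. A \<in> \<A> \<and> G\<^sub>0 (u b) \<in> A \<and> c \<notin> h ` (A \<times> b)" if "b \<in> \<B>" for b
    using n_cover_1_point[OF A, of "G\<^sub>0 (u b)"] miss that by blast
  then obtain a c where ac: "\<And>b. b \<in> \<B> \<Longrightarrow> a b \<in> \<A> \<and> G\<^sub>0 (u b) \<in> a b \<and> c b \<notin> h ` (a b \<times> b)"
    by metis
  \<comment> \<open>\<^const>\<open>Func\<close> consists of functions with a fixed value outside their domain\<close>
  define s where "s b = (if b \<in> \<B> then c b else undefined)" for b
  have s: "s \<in> Func \<B> UNIV" unfolding Func_def s_def by simp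
  obtain b where b: "b \<in> \<B>" "G\<^sub>1 (w s) \<in> b" using n_cover_1_point[OF B] by blast
  have "f (u b, w s) = c b"
    unfolding f_def using inv_into_f_f[OF u b(1)] inv_into_f_f[OF w s] b(1) by (simp add: s_def)
  then have "c b = h (G\<^sub>0 (u b), G\<^sub>1 (w s))" using G by simp
  then show False using ac[OF b(1)] b(2) by blast
qed

text \<open>
  By cardinal arithmetic, \<open>\<cc>\<^bsup>|B|\<^esup> = (2\<^sup>r)\<^bsup>|B|\<^esup> = 2\<^sup>r = \<cc>\<close>. The second equality needs an infinite \<open>r\<close>, which
  holds because \<open>2\<^sup>r\<close> is the infinite cardinal \<open>\<cc>\<close>.
\<close>

lemma enumerable_if_exponential:
  assumes less: "r <o ctwo ^c r" and eq: "ctwo ^c r =o continuum"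
    and B: "|B| \<le>o r" "B \<noteq> {}" and r: "Card_order r"
  shows "|B| \<le>o continuum" "|Func B (UNIV :: real set)| \<le>o continuum"
proof -
  show "|B| \<le>o continuum"
    using ordLess_imp_ordLeq[OF ordLess_ordIso_trans[OF ordLeq_ordLess_trans[OF B(1) less] eq]] .
  have "|Pow (Field r)| =o continuum"
    using ordIso_transitive[OF card_of_Pow_Func eq[unfolded cexp_def ctwo_def Field_card_of]] .
  then have "infinite (Field r)"
    using card_of_ordIso_finite[of "Pow (Field r)" "UNIV :: real set"] infinite_UNIV_char_0 by auto
  then have inf: "Cinfinite r" using r unfolding cinfinite_def by blast
  have nz: "Cnotzero |B|"
    using B(2) card_of_Card_order by (simp add: card_of_ordIso_czero_iff_empty)
  have "continuum ^c |B| \<le>o (ctwo ^c r) ^c |B|"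
    by (rule cexp_mono1[OF ordIso_imp_ordLeq[OF ordIso_symmetric[OF eq]] card_of_Card_order])
  also have "(ctwo ^c r) ^c |B| =o ctwo ^c r"
    by (rule cexp_cprod_ordLeq[OF Card_order_ctwo inf nz B(1)])
  also note eq
  finally show "|Func B (UNIV :: real set)| \<le>o continuum" unfolding cexp_def Field_card_of .
qed

theorem proposition4p3:
  fixes h :: "(nat \<Rightarrow> real) \<times> (nat \<Rightarrow> real) \<Rightarrow> real"
  assumes "(kappa h 1 <o ctwo ^c kappa h 1 \<and> ctwo ^c kappa h 1 =o continuum)
    \<or> (\<exists>\<mu> :: real rel. regular_cardinal \<mu> \<and> kappa h 1 \<le>o \<mu> \<and> \<mu> <o continuum)
    \<or> (\<exists>\<mu> :: real rel. regular_cardinal \<mu> \<and> kappa_minus h 2 \<le>o \<mu> \<and> \<mu> <o continuum)"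
  shows "\<not> Da h"
proof -
  have inf: "infinite (UNIV :: real set)" by (rule infinite_UNIV_char_0)
  consider (A) "kappa h 1 <o ctwo ^c kappa h 1" "ctwo ^c kappa h 1 =o continuum"
    | (B) \<mu> :: "real rel" where "regular_cardinal \<mu>" "kappa h 1 \<le>o \<mu>" "\<mu> <o continuum"
    | (C) \<mu> :: "real rel" where "regular_cardinal \<mu>" "kappa_minus h 2 \<le>o \<mu>" "\<mu> <o continuum"
    using assms by blast
  then show ?thesis
  proof cases
    case A
    obtain \<A> \<B> where k: "kappa h 1 = |\<A>| +c |\<B>|" and cov: "n_cover 1 \<A>" "n_cover 1 \<B>"
      and miss: "\<And>A B. A \<in> \<A> \<Longrightarrow> B \<in> \<B> \<Longrightarrow> h ` (A \<times> B) \<noteq> UNIV"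
      using kappa_attained[OF inf, of h 1] by metis
    have "|\<B>| \<le>o kappa h 1" unfolding k by (rule ordLeq_csum2[OF card_of_Card_order])
    moreover have "\<B> \<noteq> {}" using n_cover_1_point[OF cov(2)] by blast
    moreover have "Card_order (kappa h 1)" unfolding k by (rule Card_order_csum)
    ultimately show ?thesis
      using Da_fails_if_columns_enumerable[OF cov miss] enumerable_if_exponential[OF A] by blast
  next
    case B
    obtain \<A> \<B> where k: "kappa h 1 = |\<A>| +c |\<B>|" and cov: "n_cover 1 \<A>" "n_cover 1 \<B>"
      and miss: "\<And>A B. A \<in> \<A> \<Longrightarrow> B \<in> \<B> \<Longrightarrow> h ` (A \<times> B) \<noteq> UNIV"
      using kappa_attained[OF inf, of h 1] by metis
    have "|\<A>| \<le>o \<mu>" "|\<B>| \<le>o \<mu>"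
      using ordLeq_transitive[OF ordLeq_csum1[OF card_of_Card_order] B(2)[unfolded k]]
        ordLeq_transitive[OF ordLeq_csum2[OF card_of_Card_order] B(2)[unfolded k]] .
    then have I: "|\<A> \<times> \<B>| \<le>o \<mu>"
      using B(1) card_of_Times_ordLeq_infinite_Field
      unfolding regular_cardinal_def cinfinite_def by blast
    have "\<exists>i \<in> \<A> \<times> \<B>. p \<in> fst i \<and> q \<in> snd i" for p q
      using n_cover_1_point[OF cov(1), of p] n_cover_1_point[OF cov(2), of q] by auto
    moreover have "h ` (fst i \<times> snd i) \<noteq> UNIV" if "i \<in> \<A> \<times> \<B>" for i
      using miss that by auto
    ultimately obtain f :: "real \<times> real \<Rightarrow> real"
      where f: "\<And>G\<^sub>0 G\<^sub>1. \<exists>x y. f (x, y) \<noteq> h (G\<^sub>0 x, G\<^sub>1 y)"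
      using unrepresentable_if_rectangle_cover[OF B(1,3) I, of fst snd h] by blast
    then show ?thesis using Da_representation[of h f] by metis
  next
    case C
    obtain \<A> where k: "kappa_minus h 2 = |\<A>|" and cov: "n_cover 2 \<A>"
      and miss: "\<And>A. A \<in> \<A> \<Longrightarrow> h ` (A \<times> A) \<noteq> UNIV"
      using kappa_minus_attained[OF inf, of h 2] by metis
    have "\<exists>A \<in> \<A>. p \<in> A \<and> q \<in> A" for p q :: "nat \<Rightarrow> real"
    proof -
      \<comment> \<open>a cover of the two-element sets also covers a single point, together with any other one\<close>
      obtain q' where q': "q' \<noteq> p" "q \<in> {p, q'}"
      proof (cases "q = p")
        case True
        then show ?thesis using that[of "\<lambda>n. p n + 1"] by (auto simp: fun_eq_iff)
      qed (use that[of q] in blast)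
      then have "finite {p, q'} \<and> card {p, q'} = 2" by simp
      from cov[unfolded n_cover_def, rule_format, OF this]
      obtain A where "A \<in> \<A>" "{p, q'} \<subseteq> A" by blast
      then show ?thesis using q'(2) by blast
    qed
    then obtain f :: "real \<times> real \<Rightarrow> real"
      where f: "\<And>G\<^sub>0 G\<^sub>1. \<exists>x y. f (x, y) \<noteq> h (G\<^sub>0 x, G\<^sub>1 y)"
      using unrepresentable_if_rectangle_cover[OF C(1,3) C(2)[unfolded k], of "\<lambda>A. A" "\<lambda>A. A" h] miss by blast
    then show ?thesis using Da_representation[of h f] by metis
  qed
qed

end
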